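(* Let $G=(V,E)$ be a simple directed graph with $n=|V|$ vertices and independent edge propagation probabilities $p_e\in[0,1]$ for $e\in E$, and let $S\subseteq V$ be a seed set. Given a tree decomposition of $G$ of width $w$ with $O(n)$ bags, all Independent Cascade activation marginals $$\pi_v(S)=\mathbb{P}(v\text{ is active}\mid S),\qquad v\in V,$$ can be computed exactly in $$O\!\left(n\,2^{O(w^2)}\operatorname{poly}(w)\right)$$ arithmetic operations. In particular, for fixed $w$, the running time is linear in $n$.
   Context: Independent Cascade (IC) model, live-edge form: each edge $e\in E$ is independently live with probability $p_e$ and dead with probability $1-p_e$. A vertex $v$ is active (activated by the seed set $S$) if and only if $v$ is reachable from some vertex of $S$ by a directed path (possibly of length zero) of live edges; $\mathbb{P}(v\text{ is active}\mid S)$ is the probability of this event. A tree decomposition of a directed graph means a tree decomposition of its underlying undirected graph: a tree $\mathcal T$ with bags $B_t\subseteq V$ for $t\in V(\mathcal T)$ such that every vertex lies in some bag, every edge has both endpoints in some bag, and the bags containing any fixed vertex form a connected subtree. Its width is $\max_t|B_t|-1$. Complexity is measured as the number of arithmetic operations (on the real numbers representing probabilities). The implied constants and the polynomial are absolute (independent of $G$, $p$, $S$, $n$, $w$), apart from the constant in the bound $O(n)$ on the number of bags. *)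

theory Defs
  imports
    "Graph_Theory.Graph_Theory"
    "HOL-Probability.Product_PMF"
    "HOL-Computational_Algebra.Polynomial"
begin

section \<open>Tree decompositions\<close>

text \<open>
  Undirected graphs are symmetric digraphs, as in \<^theory>\<open>Graph_Theory.Digraph\<close>. There the
  traversal of one undirected edge in both directions counts as a directed cycle (of length 2),
  so \<^const>\<open>tree\<close> does not describe undirected trees; in a loop-free symmetric digraph without
  parallel arcs the undirected cycles are exactly the directed cycles of length at least 3.
\<close>

definition undirected_tree :: "'t pair_pre_digraph \<Rightarrow> bool" where
  "undirected_tree T \<longleftrightarrow>
     pair_graph T \<and> Digraph_Component.connected (with_proj T) \<and>
     \<not> (\<exists>c. pre_digraph.cycle (with_proj T) c \<and> length c \<ge> 3)"

text \<open>
  The edge condition ignores the orientation of arcs, so this is a tree decomposition of the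
  underlying undirected graph of \<open>G\<close>. A graph that is connected in the sense of
  \<^const>\<open>Digraph_Component.connected\<close> is nonempty, so the last condition includes that every
  vertex lies in some bag; induced subgraphs of a tree are acyclic, so they are subtrees as soon
  as they are connected.
\<close>

definition tree_decomposition ::
  "'a pair_pre_digraph \<Rightarrow> 't pair_pre_digraph \<Rightarrow> ('t \<Rightarrow> 'a set) \<Rightarrow> bool" where
  "tree_decomposition G T B \<longleftrightarrow>
     undirected_tree T \<and>
     (\<forall>t\<in>pverts T. B t \<subseteq> pverts G) \<and>
     (\<forall>v\<in>pverts G. \<exists>t\<in>pverts T. v \<in> B t) \<and>
     (\<forall>(u, v)\<in>parcs G. \<exists>t\<in>pverts T. u \<in> B t \<and> v \<in> B t) \<and>
     (\<forall>v\<in>pverts G. Digraph_Component.connected (with_proj T \<restriction> {t \<in> pverts T. v \<in> B t}))"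

text \<open>
  Subtraction is truncated. This only affects decompositions whose bags are all empty, that is,
  the empty graph \<open>G\<close>.
\<close>

definition td_width :: "'t pair_pre_digraph \<Rightarrow> ('t \<Rightarrow> 'a set) \<Rightarrow> nat" where
  "td_width T B = Max ((\<lambda>t. card (B t)) ` pverts T) - 1"


section \<open>The Independent Cascade model\<close>

text \<open>\<open>L e\<close> says that the edge \<open>e\<close> is live.\<close>

definition live_edges_pmf ::
  "'a pair_pre_digraph \<Rightarrow> ('a \<times> 'a \<Rightarrow> real) \<Rightarrow> ('a \<times> 'a \<Rightarrow> bool) pmf" where
  "live_edges_pmf G p = Pi_pmf (parcs G) False (\<lambda>e. bernoulli_pmf (p e))"

definition live_subgraph :: "'a pair_pre_digraph \<Rightarrow> ('a \<times> 'a \<Rightarrow> bool) \<Rightarrow> 'a pair_pre_digraph" where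
  "live_subgraph G L = \<lparr>pverts = pverts G, parcs = {e \<in> parcs G. L e}\<rparr>"

definition active :: "'a pair_pre_digraph \<Rightarrow> 'a set \<Rightarrow> ('a \<times> 'a \<Rightarrow> bool) \<Rightarrow> 'a \<Rightarrow> bool" where
  "active G S L v \<longleftrightarrow> (\<exists>s\<in>S. s \<rightarrow>\<^sup>*\<^bsub>with_proj (live_subgraph G L)\<^esub> v)"

definition activation_marginal ::
  "'a pair_pre_digraph \<Rightarrow> ('a \<times> 'a \<Rightarrow> real) \<Rightarrow> 'a set \<Rightarrow> 'a \<Rightarrow> real" where
  "activation_marginal G p S v = measure_pmf.prob (live_edges_pmf G p) {L. active G S L v}"


section \<open>Arithmetic programs\<close>

text \<open>
  A straight-line program is a list of instructions, each of which performs one arithmetic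
  operation on real numbers and stores the result in the next register, so the length of the list
  is the number of arithmetic operations. Operands are inputs, the constants 0 and 1, and
  results of earlier instructions; in particular, no other real constant is available.
  A value is \<open>None\<close> if it is undefined: access to a missing input or register, division by zero.
\<close>

datatype 'i operand = Input 'i | Zero | One | Reg nat

datatype arith_op = Plus | Minus | Times | Divide

datatype 'i instr = Instr arith_op "'i operand" "'i operand"

fun operand_value :: "('i \<rightharpoonup> real) \<Rightarrow> real list \<Rightarrow> 'i operand \<Rightarrow> real option" where
  "operand_value x rs (Input i) = x i"
| "operand_value x rs Zero = Some 0"
| "operand_value x rs One = Some 1"
| "operand_value x rs (Reg k) = (if k < length rs then Some (rs ! k) else None)"

fun arith_value :: "arith_op \<Rightarrow> real \<Rightarrow> real \<Rightarrow> real option" where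
  "arith_value Plus a b = Some (a + b)"
| "arith_value Minus a b = Some (a - b)"
| "arith_value Times a b = Some (a * b)"
| "arith_value Divide a b = (if b = 0 then None else Some (a / b))"

fun instr_value :: "('i \<rightharpoonup> real) \<Rightarrow> real list \<Rightarrow> 'i instr \<Rightarrow> real option" where
  "instr_value x rs (Instr f a b) =
     Option.bind (operand_value x rs a) (\<lambda>r.
     Option.bind (operand_value x rs b) (\<lambda>s. arith_value f r s))"

fun run :: "('i \<rightharpoonup> real) \<Rightarrow> 'i instr list \<Rightarrow> real list \<Rightarrow> real list option" where
  "run x [] rs = Some rs"
| "run x (c # cs) rs = Option.bind (instr_value x rs c) (\<lambda>r. run x cs (rs @ [r]))"

text \<open>\<open>result\<close> says where the value with index \<open>v\<close> is found after the run.\<close>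

datatype ('i, 'o) program = Program (instrs: "'i instr list") (result: "'o \<Rightarrow> 'i operand")

definition num_ops :: "('i, 'o) program \<Rightarrow> nat" where
  "num_ops P = length (instrs P)"

definition computes :: "('i, 'o) program \<Rightarrow> ('i \<rightharpoonup> real) \<Rightarrow> 'o set \<Rightarrow> ('o \<Rightarrow> real) \<Rightarrow> bool" where
  "computes P x V y \<longleftrightarrow>
     (\<exists>rs. run x (instrs P) [] = Some rs \<and> (\<forall>v\<in>V. operand_value x rs (result P v) = Some (y v)))"


section \<open>Algorithms for Independent Cascade marginals\<close>

text \<open>
  An algorithm sees the graph, the seed set and the tree decomposition, and produces from them the
  sequence of arithmetic operations to be performed. The edge probabilities are not among its
  arguments: they are accessible only as inputs of the program. Only arithmetic operations are
  counted, not the combinatorial work.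
\<close>

type_synonym ('a, 't) ic_algorithm =
  "'a pair_pre_digraph \<Rightarrow> 'a set \<Rightarrow> 't pair_pre_digraph \<Rightarrow> ('t \<Rightarrow> 'a set) \<Rightarrow> ('a \<times> 'a, 'a) program"

definition ic_instance ::
  "'a pair_pre_digraph \<Rightarrow> 'a set \<Rightarrow> 't pair_pre_digraph \<Rightarrow> ('t \<Rightarrow> 'a set) \<Rightarrow> bool" where
  "ic_instance G S T B \<longleftrightarrow> pair_digraph G \<and> S \<subseteq> pverts G \<and> tree_decomposition G T B"

definition computes_ic_marginals :: "('a, 't) ic_algorithm \<Rightarrow> bool" where
  "computes_ic_marginals alg \<longleftrightarrow>
     (\<forall>G S T B p. ic_instance G S T B \<longrightarrow> (\<forall>e\<in>parcs G. 0 \<le> p e \<and> p e \<le> 1) \<longrightarrow>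
        computes (alg G S T B) ((\<lambda>e. Some (p e)) |` parcs G) (pverts G)
          (activation_marginal G p S))"

end

theory Submission
  imports Defs
begin

text \<open>
  Add a source that reaches every seed with certainty, and put it into every bag. For a bag \<open>B\<close> of
  at most \<open>k\<close> vertices and a set \<open>F\<close> of edges, consider the joint distribution of the reachability
  relation of the live edges in \<open>F\<close>, observed on \<open>B\<close>; it has at most \<open>2 ^ k\<^sup>2\<close> values. If two edge
  sets only meet in vertices of their bags, the distribution of the union on a third bag is a bilinear
  function of their distributions, which costs \<open>2 ^ O(k\<^sup>2)\<close> operations. Assign every edge to a bag
  that contains it. Then the marginal of \<open>v\<close> results from joining, at a bag that contains \<open>v\<close>, the
  edges of that bag with all other edges, its environment. The environments of all bags are computed
  by induction on the tree: merge a leaf \<open>t\<close> into its neighbour \<open>q\<close>, solve the smaller tree, and obtain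
  the environments of \<open>q\<close> and \<open>t\<close> by joining the environment of the merged bag with the edges of \<open>t\<close>
  and \<open>q\<close>, respectively. This takes three joins per leaf whatever the degrees in the tree, and
  needs no division.
\<close>

section \<open>Straight-line computations on functions\<close>

text \<open>The elements of \<open>H\<close> and \<open>K\<close> are functions of the parameter
  \<open>p\<close>, not numbers, so that one sequence of operations has to serve all parameters at
  once. The number \<open>n\<close> is only an upper bound, since \<open>available\<close> holds for
  every \<open>n\<close>.\<close>

inductive straight_line :: "nat \<Rightarrow> ('p \<Rightarrow> real) set \<Rightarrow> ('p \<Rightarrow> real) set \<Rightarrow> bool" where
  available: "K \<subseteq> H \<Longrightarrow> straight_line n H K"
| operation: "f \<in> H \<Longrightarrow> g \<in> H \<Longrightarrow> \<phi> \<in> {(+), (-), (*)} \<Longrightarrow>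
    straight_line n (insert (\<lambda>p. \<phi> (f p) (g p)) H) K \<Longrightarrow> straight_line (Suc n) H K"

lemma straight_line_mono:
  assumes "straight_line n H K" "n \<le> n'" "H \<subseteq> H'" "K' \<subseteq> K"
  shows "straight_line n' H' K'"
  using assms
proof (induction n H K arbitrary: n' H' rule: straight_line.induct)
  case (available K H n)
  then show ?case by (auto intro: straight_line.available)
next
  case (operation f H g \<phi> n K)
  then obtain m where m: "n' = Suc m" "n \<le> m" by (cases n') auto
  have "straight_line m (insert (\<lambda>p. \<phi> (f p) (g p)) H') K'"
    using operation m by (intro operation.IH) auto
  then show ?case
    using operation m by (auto intro: straight_line.operation[of f H' g \<phi>])
qed

lemma straight_line_keep: "straight_line n H K \<Longrightarrow> straight_line n H (H \<union> K)"
proof (induction rule: straight_line.induct)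
  case (available K H n)
  then show ?case by (auto intro: straight_line.available)
next
  case (operation f H g \<phi> n K)
  then show ?case
    by (intro straight_line.operation[of f H g \<phi>]) (auto intro: straight_line_mono)
qed

text \<open>Registers are never overwritten, so the second computation may use \<open>H\<close> and
  \<open>K\<close> together, and \<open>K\<close> survives in the conclusion for later
  phases.\<close>

lemma straight_line_trans:
  assumes "straight_line m H K" "straight_line n (H \<union> K) K'"
  shows "straight_line (m + n) H (K \<union> K')"
  using assms
proof (induction rule: straight_line.induct)
  case (available K H m)
  then have "straight_line n H (H \<union> K')" by (simp add: sup.absorb1 straight_line_keep)
  then show ?case using available by (auto intro: straight_line_mono)
next
  case (operation f H g \<phi> m K)
  then show ?case
    by (auto intro!: straight_line.operation[of f H g \<phi>] operation.IH intro: straight_line_mono)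
qed

lemma straight_line_Un:
  assumes "straight_line m H K" "straight_line n H K'"
  shows "straight_line (m + n) H (K \<union> K')"
  using assms straight_line_trans straight_line_mono by (metis Un_upper1 order_refl)

lemma straight_line_UN:
  assumes "finite I" "\<And>i. i \<in> I \<Longrightarrow> straight_line n H (K i)"
  shows "straight_line (card I * n) H (\<Union>i\<in>I. K i)"
  using assms
proof (induction I rule: finite_induct)
  case empty
  then show ?case by (auto intro: straight_line.available)
next
  case (insert i I)
  then have "straight_line (n + card I * n) H (K i \<union> (\<Union>i\<in>I. K i))"
    by (intro straight_line_Un) auto
  with insert show ?case by simp
qed

lemma straight_line_op:
  assumes "f \<in> H" "g \<in> H" "\<phi> \<in> {(+), (-), (*)}"
  shows "straight_line 1 H {\<lambda>p. \<phi> (f p) (g p)}"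
  using straight_line.operation[OF assms straight_line.available, of _ 0] by auto

lemma straight_line_image:
  assumes "finite I" "\<And>i. i \<in> I \<Longrightarrow> straight_line n H {f i}"
  shows "straight_line (card I * n) H (f ` I)"
  using straight_line_UN[of I n H "\<lambda>i. {f i}"] assms by (simp add: UNION_singleton_eq_range)

lemma straight_line_sum:
  assumes "finite I" "(\<lambda>p. 0) \<in> H" "f ` I \<subseteq> H"
  shows "straight_line (card I) H {\<lambda>p. \<Sum>i\<in>I. f i p}"
  using assms
proof (induction I rule: finite_induct)
  case empty
  then show ?case by (auto intro: straight_line.available)
next
  case (insert i I)
  have "straight_line (card I + 1) H ({\<lambda>p. \<Sum>i\<in>I. f i p} \<union> {\<lambda>p. f i p + (\<Sum>i\<in>I. f i p)})"
    using insert by (intro straight_line_trans straight_line_op) auto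
  with insert show ?case by (auto elim: straight_line_mono)
qed

lemma straight_line_prod:
  assumes "finite I" "(\<lambda>p. 1) \<in> H" "f ` I \<subseteq> H"
  shows "straight_line (card I) H {\<lambda>p. \<Prod>i\<in>I. f i p}"
  using assms
proof (induction I rule: finite_induct)
  case empty
  then show ?case by (auto intro: straight_line.available)
next
  case (insert i I)
  have "straight_line (card I + 1) H ({\<lambda>p. \<Prod>i\<in>I. f i p} \<union> {\<lambda>p. f i p * (\<Prod>i\<in>I. f i p)})"
    using insert by (intro straight_line_trans straight_line_op) auto
  with insert show ?case by (auto elim: straight_line_mono)
qed

lemma straight_line_sum_mono:
  assumes "finite I" "(\<lambda>p. 0) \<in> H" "\<And>i. i \<in> I \<Longrightarrow> straight_line n H {f i}"
  shows "straight_line (card I * (n + 1)) H {\<lambda>p. \<Sum>i\<in>I. f i p}"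
proof -
  have "straight_line (card I * n + card I) H (f ` I \<union> {\<lambda>p. \<Sum>i\<in>I. f i p})"
    using assms by (intro straight_line_trans straight_line_image straight_line_sum) auto
  then show ?thesis by (auto simp: algebra_simps elim: straight_line_mono)
qed

section \<open>Translation into register programs\<close>

lemma run_append:
  "run x (cs @ ds) rs = Option.bind (run x cs rs) (run x ds)"
  by (induction cs arbitrary: rs) (auto intro!: Option.bind_cong)

lemma operand_value_append:
  "operand_value x rs a = Some r \<Longrightarrow> operand_value x (rs @ ss) a = Some r"
  by (cases a) (auto simp: nth_append split: if_splits)

lemma run_extends: "run x cs rs = Some rs' \<Longrightarrow> \<exists>ss. rs' = rs @ ss \<and> length ss = length cs"
proof (induction cs arbitrary: rs)
  case (Cons c cs)
  then obtain r where "run x cs (rs @ [r]) = Some rs'" by (auto simp: bind_eq_Some_conv)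
  from Cons.IH[OF this] show ?case by auto
qed simp

text \<open>Each \<open>operation\<close> step appends one instruction to the code \<open>cs\<close>
  emitted so far. The operand \<open>a\<close> is chosen before \<open>p\<close>, which makes the
  resulting code independent of the parameter.\<close>

lemma straight_line_program:
  assumes "straight_line n H K"
    and "\<And>p. p \<in> P \<Longrightarrow> run (x p) cs [] = Some (rs p)"
    and "\<And>f. f \<in> H \<Longrightarrow> \<exists>a. \<forall>p\<in>P. operand_value (x p) (rs p) a = Some (f p)"
  shows "\<exists>ds rs'. length ds \<le> n \<and> (\<forall>p\<in>P. run (x p) (cs @ ds) [] = Some (rs' p)) \<and>
    (\<forall>f\<in>K. \<exists>a. \<forall>p\<in>P. operand_value (x p) (rs' p) a = Some (f p))"
  using assms
proof (induction arbitrary: cs rs rule: straight_line.induct)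
  case (available K H n)
  then show ?case by (intro exI[of _ "[]"] exI[of _ rs]) auto
next
  case (operation f H g \<phi> n K)
  obtain a where a: "\<And>p. p \<in> P \<Longrightarrow> operand_value (x p) (rs p) a = Some (f p)"
    using operation.prems(2)[OF \<open>f \<in> H\<close>] by auto
  obtain b where b: "\<And>p. p \<in> P \<Longrightarrow> operand_value (x p) (rs p) b = Some (g p)"
    using operation.prems(2)[OF \<open>g \<in> H\<close>] by auto
  \<comment> \<open>Each of the three admissible \<phi> is the semantics of a total operation, so no
    instruction can fail; only \<open>Divide\<close> is partial.\<close>
  obtain op where op: "\<And>r s. arith_value op r s = Some (\<phi> r s)"
    using \<open>\<phi> \<in> {(+), (-), (*)}\<close> arith_value.simps(1-3)
    by (metis (mono_tags, opaque_lifting) empty_iff insert_iff)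
  define rs' where "rs' p = rs p @ [\<phi> (f p) (g p)]" for p
  have run': "run (x p) (cs @ [Instr op a b]) [] = Some (rs' p)" if "p \<in> P" for p
    using that operation.prems(1) by (simp add: run_append a b op rs'_def)
  have len: "length (rs p) = length cs" if "p \<in> P" for p
    using run_extends[OF operation.prems(1)[OF that]] by auto
  have "\<exists>c. \<forall>p\<in>P. operand_value (x p) (rs' p) c = Some (h p)"
    if "h \<in> insert (\<lambda>p. \<phi> (f p) (g p)) H" for h
  proof (cases "h \<in> H")
    case True
    then obtain c where "\<forall>p\<in>P. operand_value (x p) (rs p) c = Some (h p)"
      using operation.prems(2) by auto
    then show ?thesis unfolding rs'_def by (auto intro!: exI[of _ c] operand_value_append)
  next
    case False
    then have "h = (\<lambda>p. \<phi> (f p) (g p))" using that by auto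
    then show ?thesis
      \<comment> \<open>The run starts without registers and every instruction adds one, so the new
        value has index \<open>length cs\<close>.\<close>
      by (intro exI[of _ "Reg (length cs)"]) (auto simp: rs'_def len nth_append)
  qed
  from operation.IH[OF run' this] obtain ds rs'' where
    "length ds \<le> n" "\<forall>p\<in>P. run (x p) (cs @ Instr op a b # ds) [] = Some (rs'' p)"
    "\<forall>f\<in>K. \<exists>a. \<forall>p\<in>P. operand_value (x p) (rs'' p) a = Some (f p)"
    by (metis append.assoc append_Cons append_Nil)
  then show ?case
    by (intro exI[of _ "Instr op a b # ds"] exI[of _ rs'']) auto
qed

section \<open>Reachability observed on a separator\<close>

text \<open>The closure is taken before restricting: paths may leave \<open>X\<close>, only their
  endpoints are observed.\<close>

definition reach_on :: "'v set \<Rightarrow> 'v rel \<Rightarrow> 'v rel" where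
  "reach_on X L = Restr (L\<^sup>*) X"

lemma reach_on_subset: "reach_on X L \<subseteq> X \<times> X"
  by (auto simp: reach_on_def)

text \<open>A path in the union splits into segments within one side. The segments start and end at
  vertices that their side observes, so each can be replaced by a single observed pair.\<close>

lemma reach_on_Un:
  assumes L: "L1 \<subseteq> W1 \<times> W1" "L2 \<subseteq> W2 \<times> W2"
    and sep: "W1 \<inter> W2 \<subseteq> X1 \<inter> X2" "W1 \<inter> Y \<subseteq> X1" "W2 \<inter> Y \<subseteq> X2"
  shows "reach_on Y (L1 \<union> L2) = reach_on Y (reach_on X1 L1 \<union> reach_on X2 L2)"
proof -
  define M where "M = reach_on X1 L1 \<union> reach_on X2 L2"
  have "M \<subseteq> (L1 \<union> L2)\<^sup>*"
    unfolding M_def reach_on_def using rtrancl_mono[of L1 "L1 \<union> L2"] rtrancl_mono[of L2 "L1 \<union> L2"] by auto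
  then have "M\<^sup>* \<subseteq> (L1 \<union> L2)\<^sup>*" by (metis rtrancl_mono rtrancl_idemp)
  moreover have "(a, b) \<in> M\<^sup>*" if "(a, b) \<in> (L1 \<union> L2)\<^sup>*" and Y: "a \<in> Y" "b \<in> Y" for a b
  proof -
    \<comment> \<open>A path only changes sides at a vertex of \<open>W1 \<inter> W2\<close>, which both observers see.\<close>
    have "(a, b) \<in> M\<^sup>* \<and> (b \<in> W1 \<longrightarrow> b \<in> X1) \<and> (b \<in> W2 \<longrightarrow> b \<in> X2) \<or>
      (\<exists>x\<in>X1. (a, x) \<in> M\<^sup>* \<and> (x, b) \<in> L1\<^sup>* \<and> b \<in> W1) \<or>
      (\<exists>x\<in>X2. (a, x) \<in> M\<^sup>* \<and> (x, b) \<in> L2\<^sup>* \<and> b \<in> W2)"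
      using that(1)
    proof (induction rule: rtrancl_induct)
      case base
      then show ?case using Y sep by auto
    next
      case (step c d)
      \<comment> \<open>An unfinished last segment becomes a step of \<open>M\<close> once its
        endpoint is observed.\<close>
      have via1: "(a, c) \<in> M\<^sup>*" if "(a, x) \<in> M\<^sup>*" "x \<in> X1" "c \<in> X1" "(x, c) \<in> L1\<^sup>*" for x
        using that by (auto simp: M_def reach_on_def intro: rtrancl_into_rtrancl)
      have via2: "(a, c) \<in> M\<^sup>*" if "(a, x) \<in> M\<^sup>*" "x \<in> X2" "c \<in> X2" "(x, c) \<in> L2\<^sup>*" for x
        using that by (auto simp: M_def reach_on_def intro: rtrancl_into_rtrancl)
      consider "(c, d) \<in> L1" | "(c, d) \<in> L2" using step by auto
      then show ?case
      proof cases
        case 1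
        then have W: "c \<in> W1" "d \<in> W1" using L by auto
        then have "c \<in> W2 \<Longrightarrow> c \<in> X1 \<inter> X2" using sep by auto
        with step.IH W have "\<exists>x\<in>X1. (a, x) \<in> M\<^sup>* \<and> (x, c) \<in> L1\<^sup>*" using via2 by blast
        then show ?thesis using 1 W by (meson rtrancl.rtrancl_into_rtrancl)
      next
        case 2
        then have W: "c \<in> W2" "d \<in> W2" using L by auto
        then have "c \<in> W1 \<Longrightarrow> c \<in> X1 \<inter> X2" using sep by auto
        with step.IH W have "\<exists>x\<in>X2. (a, x) \<in> M\<^sup>* \<and> (x, c) \<in> L2\<^sup>*" using via1 by blast
        then show ?thesis using 2 W by (meson rtrancl.rtrancl_into_rtrancl)
      qed
    qed
    \<comment> \<open>The final vertex lies in \<open>Y\<close>, hence is observed by each side that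
      contains it; this closes the last segment.\<close>
    moreover have "(x, b) \<in> M" if "x \<in> X1" "(x, b) \<in> L1\<^sup>*" "b \<in> W1" for x
      using that Y sep by (auto simp: M_def reach_on_def)
    moreover have "(x, b) \<in> M" if "x \<in> X2" "(x, b) \<in> L2\<^sup>*" "b \<in> W2" for x
      using that Y sep by (auto simp: M_def reach_on_def)
    ultimately show ?thesis by (meson rtrancl.rtrancl_into_rtrancl)
  qed
  ultimately show ?thesis unfolding M_def[symmetric] reach_on_def[of Y] by auto
qed

section \<open>Distribution of the observed reachability\<close>

text \<open>For \<open>y e\<close> in [0,1] this is the probability that \<open>L\<close> is the
  live part of \<open>F\<close>. As a finite product it makes the following facts polynomial
  identities in arbitrary real \<open>y\<close>.\<close>

definition config_weight :: "('e \<Rightarrow> real) \<Rightarrow> 'e set \<Rightarrow> 'e set \<Rightarrow> real" where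
  "config_weight y F L = (\<Prod>e\<in>F. if e \<in> L then y e else 1 - y e)"

definition live_expect :: "('e \<Rightarrow> real) \<Rightarrow> 'e set \<Rightarrow> ('e set \<Rightarrow> real) \<Rightarrow> real" where
  "live_expect y F h = (\<Sum>L\<in>Pow F. config_weight y F L * h L)"

definition reach_dist :: "('v \<times> 'v \<Rightarrow> real) \<Rightarrow> 'v rel \<Rightarrow> 'v set \<Rightarrow> 'v rel \<Rightarrow> real" where
  "reach_dist y F X r = live_expect y F (\<lambda>L. of_bool (reach_on X L = r))"

lemma live_expect_cong:
  assumes "\<And>L. L \<subseteq> F \<Longrightarrow> h L = h' L"
  shows "live_expect y F h = live_expect y F h'"
  using assms by (auto simp: live_expect_def intro!: sum.cong)

text \<open>Independence of disjoint edge sets, in the form of Fubini: \<open>L\<close> corresponds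
  to the pair of its traces on \<open>F1\<close> and \<open>F2\<close>.\<close>

lemma live_expect_Un:
  assumes "finite F1" "finite F2" "F1 \<inter> F2 = {}"
  shows "live_expect y (F1 \<union> F2) h = live_expect y F1 (\<lambda>L1. live_expect y F2 (\<lambda>L2. h (L1 \<union> L2)))"
proof -
  have w: "config_weight y (F1 \<union> F2) (L1 \<union> L2) = config_weight y F1 L1 * config_weight y F2 L2"
    if "L1 \<subseteq> F1" "L2 \<subseteq> F2" for L1 L2
    unfolding config_weight_def using assms that
    by (subst prod.union_disjoint) (auto intro!: arg_cong2[of _ _ _ _ "(*)"] prod.cong)
  have "live_expect y (F1 \<union> F2) h =
      (\<Sum>(L1, L2)\<in>Pow F1 \<times> Pow F2. config_weight y (F1 \<union> F2) (L1 \<union> L2) * h (L1 \<union> L2))"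
    unfolding live_expect_def using assms
    by (intro sum.reindex_bij_witness[of _ "\<lambda>(L1, L2). L1 \<union> L2" "\<lambda>L. (L \<inter> F1, L \<inter> F2)"])
      (auto intro!: arg_cong2[of _ _ _ _ "(*)"] arg_cong[of _ _ h] arg_cong[of _ _ "config_weight y _"])
  also have "\<dots> = (\<Sum>(L1, L2)\<in>Pow F1 \<times> Pow F2. config_weight y F1 L1 * (config_weight y F2 L2 * h (L1 \<union> L2)))"
    by (intro sum.cong) (auto simp: w)
  also have "\<dots> = live_expect y F1 (\<lambda>L1. live_expect y F2 (\<lambda>L2. h (L1 \<union> L2)))"
    unfolding live_expect_def by (simp add: sum.cartesian_product[symmetric] sum_distrib_left)
  finally show ?thesis .
qed

text \<open>Configurations are grouped by the relation that they induce on \<open>X\<close>.\<close>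

lemma live_expect_reach_on:
  assumes "finite X"
  shows "live_expect y F (\<lambda>L. g (reach_on X L)) = (\<Sum>r\<in>Pow (X \<times> X). reach_dist y F X r * g r)"
proof -
  have "(\<Sum>r\<in>Pow (X \<times> X). reach_dist y F X r * g r) =
    (\<Sum>L\<in>Pow F. \<Sum>r\<in>Pow (X \<times> X). config_weight y F L * of_bool (reach_on X L = r) * g r)"
    unfolding reach_dist_def live_expect_def sum_distrib_right by (rule sum.swap)
  also have "\<dots> = (\<Sum>L\<in>Pow F. config_weight y F L * g (reach_on X L))"
  proof (rule sum.cong)
    fix L assume "L \<in> Pow F"
    have "(\<Sum>r\<in>Pow (X \<times> X). config_weight y F L * of_bool (reach_on X L = r) * g r) =
        (\<Sum>r\<in>Pow (X \<times> X). if reach_on X L = r then config_weight y F L * g r else 0)"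
      by (intro sum.cong) auto
    also have "\<dots> = config_weight y F L * g (reach_on X L)"
      using assms reach_on_subset[of X L] by (subst sum.delta') auto
    finally show "(\<Sum>r\<in>Pow (X \<times> X). config_weight y F L * of_bool (reach_on X L = r) * g r) =
      config_weight y F L * g (reach_on X L)" .
  qed simp
  finally show ?thesis by (simp add: live_expect_def)
qed

text \<open>By independence and \<open>reach_on_Un\<close>, only the two observed relations matter.
  The sum ranges over pairs of relations on \<open>X1\<close> and \<open>X2\<close>, whatever the
  number of edges.\<close>

lemma live_expect_join:
  assumes "finite F1" "finite F2" "F1 \<inter> F2 = {}" "finite X1" "finite X2"
    and "F1 \<subseteq> W1 \<times> W1" "F2 \<subseteq> W2 \<times> W2"
    and "W1 \<inter> W2 \<subseteq> X1 \<inter> X2" "W1 \<inter> Y \<subseteq> X1" "W2 \<inter> Y \<subseteq> X2"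
  shows "live_expect y (F1 \<union> F2) (\<lambda>L. g (reach_on Y L)) =
    (\<Sum>(r1, r2)\<in>Pow (X1 \<times> X1) \<times> Pow (X2 \<times> X2).
      reach_dist y F1 X1 r1 * reach_dist y F2 X2 r2 * g (reach_on Y (r1 \<union> r2)))"
proof -
  have "live_expect y (F1 \<union> F2) (\<lambda>L. g (reach_on Y L)) =
      live_expect y F1 (\<lambda>L1. live_expect y F2 (\<lambda>L2. g (reach_on Y (L1 \<union> L2))))"
    using assms by (intro live_expect_Un)
  also have "\<dots> = live_expect y F1 (\<lambda>L1. live_expect y F2
      (\<lambda>L2. g (reach_on Y (reach_on X1 L1 \<union> reach_on X2 L2))))"
    using assms by (intro live_expect_cong arg_cong[of _ _ g] reach_on_Un[of _ W1 _ W2]) auto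
  also have "\<dots> = (\<Sum>r1\<in>Pow (X1 \<times> X1). reach_dist y F1 X1 r1 *
      (\<Sum>r2\<in>Pow (X2 \<times> X2). reach_dist y F2 X2 r2 * g (reach_on Y (r1 \<union> r2))))"
    by (simp only: live_expect_reach_on[OF \<open>finite X2\<close>, of _ _ "\<lambda>r. g (reach_on Y (_ \<union> r))"]
      live_expect_reach_on[OF \<open>finite X1\<close>, of _ _ "\<lambda>r1. \<Sum>r2\<in>_. _ r2 * g (reach_on Y (r1 \<union> r2))"])
  finally show ?thesis
    by (simp add: sum.cartesian_product[symmetric] sum_distrib_left mult.assoc)
qed

section \<open>Operation counts for joins and single bags\<close>

definition dist_funs :: "('p \<Rightarrow> 'v \<times> 'v \<Rightarrow> real) \<Rightarrow> 'v rel \<Rightarrow> 'v set \<Rightarrow> ('p \<Rightarrow> real) set" where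
  "dist_funs y F X = (\<lambda>r p. reach_dist (y p) F X r) ` Pow (X \<times> X)"

text \<open>There are at most \<open>2 ^ k\<^sup>2\<close> relations on the target bag, and each
  sums over at most \<open>2 ^ (2 * k\<^sup>2)\<close> pairs, with one multiplication and one
  addition per pair.\<close>

definition join_ops :: "nat \<Rightarrow> nat" where
  "join_ops k = 2 * 2 ^ (3 * k\<^sup>2)"

lemma card_Pow_square_le:
  assumes "finite X" "card X \<le> k"
  shows "card (Pow (X \<times> X)) \<le> 2 ^ k\<^sup>2"
  using assms by (simp add: card_Pow card_cartesian_product power2_eq_square mult_le_mono)

lemma straight_line_dist_funs:
  assumes "finite Y" "card Y \<le> k"
    and "\<And>r. straight_line (2 * 2 ^ (2 * k\<^sup>2)) H {\<lambda>p. reach_dist (y p) F Y r}"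
  shows "straight_line (join_ops k) H (dist_funs y F Y)"
proof -
  have "straight_line (card (Pow (Y \<times> Y)) * (2 * 2 ^ (2 * k\<^sup>2))) H (dist_funs y F Y)"
    unfolding dist_funs_def using assms by (intro straight_line_image) auto
  moreover have "card (Pow (Y \<times> Y)) * (2 * 2 ^ (2 * k\<^sup>2)) \<le> 2 ^ k\<^sup>2 * (2 * 2 ^ (2 * k\<^sup>2))"
    using assms by (intro mult_right_mono card_Pow_square_le) auto
  moreover have "(2::nat) ^ k\<^sup>2 * (2 * 2 ^ (2 * k\<^sup>2)) = join_ops k"
    by (simp add: join_ops_def power_add[symmetric])
  ultimately show ?thesis by (auto elim: straight_line_mono)
qed

text \<open>A general predicate \<open>Q\<close> covers both the entries of a distribution and the
  final event that the source reaches \<open>v\<close>.\<close>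

lemma straight_line_join_event:
  assumes fin: "finite F1" "finite F2" "F1 \<inter> F2 = {}" "finite X1" "finite X2"
    and sep: "F1 \<subseteq> W1 \<times> W1" "F2 \<subseteq> W2 \<times> W2"
      "W1 \<inter> W2 \<subseteq> X1 \<inter> X2" "W1 \<inter> Y \<subseteq> X1" "W2 \<inter> Y \<subseteq> X2"
    and k: "card X1 \<le> k" "card X2 \<le> k"
    and H: "(\<lambda>p. 0) \<in> H" "dist_funs y F1 X1 \<subseteq> H" "dist_funs y F2 X2 \<subseteq> H"
  shows "straight_line (2 * 2 ^ (2 * k\<^sup>2)) H
    {\<lambda>p. live_expect (y p) (F1 \<union> F2) (\<lambda>L. of_bool (Q (reach_on Y L)))}"
proof -
  \<comment> \<open>The 0/1 coefficients do not depend on \<open>p\<close>: selecting the pairs is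
    combinatorial and costs no arithmetic.\<close>
  define I where "I = {(r1, r2) \<in> Pow (X1 \<times> X1) \<times> Pow (X2 \<times> X2). Q (reach_on Y (r1 \<union> r2))}"
  define f where "f = (\<lambda>(r1, r2) p. reach_dist (y p) F1 X1 r1 * reach_dist (y p) F2 X2 r2)"
  have fin_prod: "finite (Pow (X1 \<times> X1) \<times> Pow (X2 \<times> X2))" using fin by auto
  have sub: "I \<subseteq> Pow (X1 \<times> X1) \<times> Pow (X2 \<times> X2)" by (auto simp: I_def)
  have "card I \<le> card (Pow (X1 \<times> X1)) * card (Pow (X2 \<times> X2))"
    using card_mono[OF fin_prod sub] by (simp add: card_cartesian_product)
  also have "\<dots> \<le> 2 ^ k\<^sup>2 * 2 ^ k\<^sup>2"
    using fin k by (intro mult_mono card_Pow_square_le) auto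
  finally have card: "card I * (1 + 1) \<le> 2 * 2 ^ (2 * k\<^sup>2)"
    by (simp add: mult_2 power_add)
  have "straight_line 1 H {f i}" if "i \<in> I" for i
    using that H unfolding f_def I_def dist_funs_def
    by (auto intro!: straight_line_op[of _ _ _ "(*)", unfolded One_nat_def])
  then have "straight_line (card I * (1 + 1)) H {\<lambda>p. \<Sum>i\<in>I. f i p}"
    using H finite_subset[OF sub fin_prod] by (intro straight_line_sum_mono) auto
  moreover have "(\<lambda>p. \<Sum>i\<in>I. f i p) =
      (\<lambda>p. live_expect (y p) (F1 \<union> F2) (\<lambda>L. of_bool (Q (reach_on Y L))))"
  proof
    fix p
    have "live_expect (y p) (F1 \<union> F2) (\<lambda>L. of_bool (Q (reach_on Y L))) =
      (\<Sum>(r1, r2)\<in>Pow (X1 \<times> X1) \<times> Pow (X2 \<times> X2).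
        reach_dist (y p) F1 X1 r1 * reach_dist (y p) F2 X2 r2 * of_bool (Q (reach_on Y (r1 \<union> r2))))"
      using fin sep by (rule live_expect_join)
    also have "\<dots> = (\<Sum>i\<in>I. f i p)"
      using sub fin_prod by (intro sum.mono_neutral_cong_right) (auto simp: I_def f_def)
    finally show "(\<Sum>i\<in>I. f i p) = live_expect (y p) (F1 \<union> F2) (\<lambda>L. of_bool (Q (reach_on Y L)))" ..
  qed
  ultimately show ?thesis using card by (auto elim: straight_line_mono)
qed

lemma straight_line_join:
  assumes "finite F1" "finite F2" "F1 \<inter> F2 = {}" "finite X1" "finite X2"
    and "F1 \<subseteq> W1 \<times> W1" "F2 \<subseteq> W2 \<times> W2"
      "W1 \<inter> W2 \<subseteq> X1 \<inter> X2" "W1 \<inter> Y \<subseteq> X1" "W2 \<inter> Y \<subseteq> X2"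
    and "card X1 \<le> k" "card X2 \<le> k" "finite Y" "card Y \<le> k"
    and "(\<lambda>p. 0) \<in> H" "dist_funs y F1 X1 \<subseteq> H" "dist_funs y F2 X2 \<subseteq> H"
  shows "straight_line (join_ops k) H (dist_funs y (F1 \<union> F2) Y)"
  using assms unfolding reach_dist_def
  by (intro straight_line_dist_funs straight_line_join_event[of F1 F2 X1 X2 W1 W2, folded reach_dist_def])
    (auto simp: reach_dist_def intro!: straight_line_join_event[of F1 F2 X1 X2 W1 W2])

text \<open>Brute force: a bag carries at most \<open>k\<^sup>2\<close> edges, hence
  \<open>2 ^ k\<^sup>2\<close> configurations, each with a product of \<open>2 * k\<^sup>2\<close>
  operations and one addition. As \<open>k\<^sup>2 < 2 ^ k\<^sup>2\<close>, this stays within the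
  cost of a join.\<close>

lemma straight_line_initial:
  assumes F: "F \<subseteq> X \<times> X" and X: "finite X" "card X \<le> k"
    and H: "(\<lambda>p. 0) \<in> H" "(\<lambda>p. 1) \<in> H" "\<And>e. e \<in> F \<Longrightarrow> (\<lambda>p. y p e) \<in> H"
  shows "straight_line (join_ops k) H (dist_funs y F X)"
proof (rule straight_line_dist_funs)
  fix r
  have fin: "finite F" using F X by (auto intro: finite_subset)
  have "card F \<le> card (X \<times> X)" using F X by (intro card_mono) auto
  then have cF: "card F \<le> k\<^sup>2"
    using X by (auto simp: card_cartesian_product power2_eq_square intro: order_trans mult_le_mono)
  have "card (Pow F) \<le> 2 ^ k\<^sup>2" using fin cF by (simp add: card_Pow)
  define f where "f L e p = (if e \<in> L then y p e else 1 - y p e)" for L e p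
  define I where "I = {L \<in> Pow F. reach_on X L = r}"
  have "I \<subseteq> Pow F" by (auto simp: I_def)
  then have I: "finite I" "card I \<le> 2 ^ k\<^sup>2"
    using fin \<open>card (Pow F) \<le> 2 ^ k\<^sup>2\<close> card_mono[of "Pow F" I] finite_subset[of I "Pow F"] by auto
  have "straight_line 1 H {f L e}" if "e \<in> F" for L e
  proof (cases "e \<in> L")
    case True
    then show ?thesis using H(3)[OF that] unfolding f_def by (auto intro: straight_line.available)
  next
    case False
    then show ?thesis using H(2) H(3)[OF that] unfolding f_def
      by (auto intro!: straight_line_op[of _ _ _ "(-)", unfolded One_nat_def])
  qed
  then have "straight_line (card F * 1 + card F) H (f L ` F \<union> {\<lambda>p. \<Prod>e\<in>F. f L e p})" for L
    using fin H by (intro straight_line_trans straight_line_image straight_line_prod) auto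
  then have "straight_line (2 * k\<^sup>2) H {\<lambda>p. \<Prod>e\<in>F. f L e p}" for L
    by (rule straight_line_mono) (use cF in auto)
  then have "straight_line (card I * (2 * k\<^sup>2 + 1)) H {\<lambda>p. \<Sum>L\<in>I. \<Prod>e\<in>F. f L e p}"
    using I H by (intro straight_line_sum_mono) auto
  moreover have "(\<lambda>p. \<Sum>L\<in>I. \<Prod>e\<in>F. f L e p) = (\<lambda>p. reach_dist (y p) F X r)"
    unfolding reach_dist_def live_expect_def config_weight_def f_def
    using fin by (intro ext sum.mono_neutral_cong_left) (auto simp: I_def)
  moreover have "card I * (2 * k\<^sup>2 + 1) \<le> 2 * 2 ^ (2 * k\<^sup>2)"
  proof -
    have "k\<^sup>2 < 2 ^ k\<^sup>2" by simp
    then have "card I * (2 * k\<^sup>2 + 1) \<le> 2 ^ k\<^sup>2 * (2 * 2 ^ k\<^sup>2)" 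
      by (intro mult_mono I) linarith+
    also have "\<dots> = 2 * 2 ^ (2 * k\<^sup>2)" by (simp add: mult_2[of "k\<^sup>2"] power_add)
    finally show ?thesis .
  qed
  ultimately show "straight_line (2 * 2 ^ (2 * k\<^sup>2)) H {\<lambda>p. reach_dist (y p) F X r}"
    by (auto elim: straight_line_mono)
qed (use X in auto)

text \<open>Without edges the distribution is a point mass. This is the environment of a bag that is
  alone in its tree.\<close>

lemma dist_funs_empty: "dist_funs y {} X \<subseteq> {\<lambda>p. 0, \<lambda>p. 1}"
proof -
  have "reach_dist (y p) {} X r = of_bool (reach_on X {} = r)" for p r
    by (simp add: reach_dist_def live_expect_def config_weight_def)
  then have "(\<lambda>p. reach_dist (y p) {} X r) \<in> {\<lambda>p. 0, \<lambda>p. 1}" for r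
    by (cases "reach_on X {} = r") auto
  then show ?thesis by (auto simp: dist_funs_def)
qed

section \<open>Message passing along a running intersection order\<close>

text \<open>A tree built by attaching leaves: \<open>t\<close> is the new leaf and \<open>q\<close>
  its neighbour.\<close>

inductive running_intersection :: "('t \<Rightarrow> 'v set) \<Rightarrow> 't set \<Rightarrow> bool" for B where
  single: "running_intersection B {t}"
| insert: "running_intersection B U \<Longrightarrow> t \<notin> U \<Longrightarrow> q \<in> U \<Longrightarrow> (\<And>u. u \<in> U \<Longrightarrow> B t \<inter> B u \<subseteq> B q) \<Longrightarrow>
    running_intersection B (insert t U)"

lemma running_intersection_finite: "running_intersection B U \<Longrightarrow> finite U"
  by (induction rule: running_intersection.induct) auto

text \<open>\<open>W t\<close> encloses the vertices of the edges currently held at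
  \<open>t\<close>. It grows under merging and may then exceed \<open>B t\<close>, whereas the bags,
  and with them the cost of a join, stay the same. The condition on \<open>W s \<inter> W t\<close>,
  used in both orders, says that bags separate the edge sets.\<close>

lemma straight_line_environments:
  assumes "running_intersection B U"
    and "\<And>t. t \<in> U \<Longrightarrow> finite (B t) \<and> card (B t) \<le> k"
    and "\<And>t. t \<in> U \<Longrightarrow> finite (F t) \<and> F t \<subseteq> W t \<times> W t \<and> B t \<subseteq> W t"
    and "\<And>s t. s \<in> U \<Longrightarrow> t \<in> U \<Longrightarrow> s \<noteq> t \<Longrightarrow> F s \<inter> F t = {} \<and> W s \<inter> W t \<subseteq> B s"
    and "(\<lambda>p. 0) \<in> H" "(\<lambda>p. 1) \<in> H"
    and "\<And>t. t \<in> U \<Longrightarrow> dist_funs y (F t) (B t) \<subseteq> H"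
  shows "straight_line (3 * join_ops k * card U) H (\<Union>t\<in>U. dist_funs y (\<Union>s\<in>U - {t}. F s) (B t))"
  using assms
proof (induction arbitrary: F W H rule: running_intersection.induct)
  case (single t)
  then show ?case using dist_funs_empty[of y "B t"] by (auto intro!: straight_line.available)
next
  case (insert U t q)
  note bags = insert.prems(1) and edges = insert.prems(2) and sep = insert.prems(3)
  have tq: "t \<noteq> q" using insert.hyps by auto
  define F' where "F' = F(q := F q \<union> F t)"
  define W' where "W' = W(q := W q \<union> W t)"
  define M where "M = dist_funs y (F q \<union> F t) (B q)"
  define D where "D = (\<Union>u\<in>U. dist_funs y (\<Union>s\<in>U - {u}. F' s) (B u))"
  define E where "E = (\<Union>s\<in>U - {q}. F s)"
  define V where "V = B q \<union> (\<Union>s\<in>U - {q}. W s)"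
  have fin: "finite U" using insert.hyps running_intersection_finite by auto
  \<comment> \<open>Separation puts a shared vertex into \<open>B s\<close> and \<open>B t\<close>,
    and the running intersection property then puts it into \<open>B q\<close>.\<close>
  have Wt: "W s \<inter> W t \<subseteq> B q \<inter> B s \<inter> B t" if "s \<in> U" for s
  proof -
    have "W s \<inter> W t \<subseteq> B s" "W t \<inter> W s \<subseteq> B t" using sep[of s t] sep[of t s] that insert.hyps by auto
    then show ?thesis using insert.hyps(4)[OF that] by blast
  qed
  have Wq: "W s \<inter> W q \<subseteq> B q \<inter> B s" if "s \<in> U" "s \<noteq> q" for s
    using sep[of s q] sep[of q s] that insert.hyps by blast
  \<comment> \<open>First join: the distribution of the merged node, which keeps the bag
    \<open>B q\<close>.\<close>
  have "straight_line (join_ops k) H M"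
    unfolding M_def using bags[of q] bags[of t] edges[of q] edges[of t] sep[of q t] insert.hyps tq Wt[of q]
      insert.prems(4) insert.prems(6)[of q] insert.prems(6)[of t]
    by (intro straight_line_join[of _ _ "B q" "B t" "W q" "W t"]) blast+
  moreover have "straight_line (3 * join_ops k * card U) (H \<union> M) D"
    unfolding D_def
  proof (rule insert.IH)
    fix u assume u: "u \<in> U"
    then show "finite (B u) \<and> card (B u) \<le> k" using bags by auto
    show "finite (F' u) \<and> F' u \<subseteq> W' u \<times> W' u \<and> B u \<subseteq> W' u"
      using edges[of u] edges[of t] u by (auto simp: F'_def W'_def)
    show "dist_funs y (F' u) (B u) \<subseteq> H \<union> M"
      using insert.prems(6)[of u] u by (auto simp: F'_def M_def)
    fix s assume s: "s \<in> U" "s \<noteq> u"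
    have "F s \<inter> F u = {}" "F s \<inter> F t = {}" "F u \<inter> F t = {}"
      using sep[of s u] sep[of s t] sep[of u t] s u insert.hyps by auto
    moreover have "W s \<inter> W u \<subseteq> B s" using sep[of s u] s u by auto
    ultimately show "F' s \<inter> F' u = {} \<and> W' s \<inter> W' u \<subseteq> B s"
      using Wt[OF s(1)] Wt[OF u] s(2) by (auto simp: F'_def W'_def)
  qed (use insert.prems in auto)
  \<comment> \<open>The other two joins. \<open>E\<close> is the environment of the merged node,
    already available in \<open>D\<close>; adding \<open>F t\<close> gives the environment of
    \<open>q\<close>, adding \<open>F q\<close> that of \<open>t\<close>.\<close>
  moreover have "straight_line (join_ops k + join_ops k) (H \<union> M \<union> D)
    (dist_funs y (E \<union> F t) (B q) \<union> dist_funs y (E \<union> F q) (B t))"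
  proof -
    have D: "dist_funs y E (B q) \<subseteq> D"
    proof -
      have "(\<Union>s\<in>U - {q}. F' s) = E" by (auto simp: F'_def E_def)
      then show ?thesis using insert.hyps unfolding D_def by blast
    qed
    have E: "finite E" "E \<subseteq> V \<times> V" using fin edges by (auto simp: E_def V_def)
    have "F s \<inter> F t = {}" "F s \<inter> F q = {}" if "s \<in> U - {q}" for s
      using sep[of s t] sep[of s q] that insert.hyps by auto
    then have EF: "E \<inter> F t = {}" "E \<inter> F q = {}" unfolding E_def by blast+
    have V: "V \<inter> W t \<subseteq> B q \<inter> B t" "V \<inter> W q \<subseteq> B q"
      using Wt[of q] edges[of q] insert.hyps unfolding V_def by (blast dest: subsetD[OF Wt] subsetD[OF Wq])+
    have Bt: "B t \<subseteq> W t" "W q \<inter> B t \<subseteq> B q" "W t \<inter> B q \<subseteq> B t"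
      using edges[of t] edges[of q] Wt[of q] insert.hyps by auto
    have "V \<inter> B q \<subseteq> B q" "V \<inter> B t \<subseteq> B q" using V Bt by auto
    show ?thesis
      apply (intro straight_line_Un)
      subgoal
        using bags[of q] bags[of t] edges[of t] insert.hyps insert.prems(4) insert.prems(6)[of t] D E EF V Bt
        by (intro straight_line_join[of _ _ "B q" "B t" V "W t"]) auto
      subgoal
        using bags[of q] bags[of t] edges[of q] insert.hyps insert.prems(4) insert.prems(6)[of q] D E EF V Bt
        by (intro straight_line_join[of _ _ "B q" "B q" V "W q"]) auto
      done
  qed
  ultimately have "straight_line (join_ops k + (3 * join_ops k * card U + (join_ops k + join_ops k))) H
    (M \<union> (D \<union> (dist_funs y (E \<union> F t) (B q) \<union> dist_funs y (E \<union> F q) (B t))))"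
    by (rule straight_line_trans[OF _ straight_line_trans])
  then show ?case
  proof (rule straight_line_mono)
    have "dist_funs y (\<Union>s\<in>insert t U - {u}. F s) (B u) \<subseteq>
      D \<union> (dist_funs y (E \<union> F t) (B q) \<union> dist_funs y (E \<union> F q) (B t))" if u: "u \<in> insert t U" for u
    proof -
      consider "u = t" | "u = q" | "u \<in> U" "u \<noteq> q" "u \<noteq> t" using u by blast
      then show ?thesis
      proof cases
        case 1
        then have "(\<Union>s\<in>insert t U - {u}. F s) = E \<union> F q" using insert.hyps by (auto simp: E_def)
        then show ?thesis using 1 by auto
      next
        case 2
        then have "(\<Union>s\<in>insert t U - {u}. F s) = E \<union> F t" using insert.hyps by (auto simp: E_def)
        then show ?thesis using 2 by auto
      next
        \<comment> \<open>All other environments contain both \<open>t\<close> and \<open>q\<close>,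
          so merging these two does not change them.\<close>
        case 3
        then have "(\<Union>s\<in>insert t U - {u}. F s) = (\<Union>s\<in>U - {u}. F' s)"
          using insert.hyps by (auto simp: F'_def split: if_splits)
        then show ?thesis using 3 unfolding D_def by auto
      qed
    qed
    then show "(\<Union>u\<in>insert t U. dist_funs y (\<Union>s\<in>insert t U - {u}. F s) (B u)) \<subseteq>
      M \<union> (D \<union> (dist_funs y (E \<union> F t) (B q) \<union> dist_funs y (E \<union> F q) (B t)))" by blast
  qed (use fin insert.hyps in \<open>auto simp: algebra_simps\<close>)
qed

section \<open>Tree decompositions have the running intersection property\<close>

text \<open>A connection avoiding the arc contains a simple path. A path of length 1 would be the
  arc itself, so the length is at least 2, and closing the path with \<open>(q, t)\<close> gives a
  forbidden cycle of length at least 3.\<close>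

lemma undirected_tree_arc_is_bridge:
  assumes T: "undirected_tree T" and e: "(t, q) \<in> parcs T"
  shows "(t, q) \<notin> (parcs T - {(t, q)})\<^sup>*"
proof
  assume path: "(t, q) \<in> (parcs T - {(t, q)})\<^sup>*"
  interpret T: pair_graph T using T by (simp add: undirected_tree_def)
  define T' where "T' = \<lparr>pverts = pverts T, parcs = parcs T - {(t, q)}\<rparr>"
  interpret T': pair_wf_digraph T'
    by unfold_locales (auto simp: T'_def intro: T.in_arcsD1 T.in_arcsD2)
  have tq: "t \<noteq> q" "t \<in> pverts T" using e T.no_loops' T.in_arcsD1 by auto
  have "t \<rightarrow>\<^sup>*\<^bsub>with_proj T'\<^esub> q"
    using path tq by (subst T'.reachable_conv') (auto simp: T'_def)
  then obtain P where P: "T'.apath t P q" using T'.reachable_apath by auto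
  have walk': "t \<in> pverts T'" "set P \<subseteq> parcs T'" "pcas t P q"
    using P by (auto simp: T'.apath_def T'.awalk_def)
  then have arcs: "set P \<subseteq> parcs T - {(t, q)}" by (simp add: T'_def)
  have len: "length P \<ge> 2"
  proof (rule ccontr)
    assume "\<not> length P \<ge> 2"
    then consider "P = []" | a where "P = [a]"
      by (cases P; cases "tl P") auto
    then show False
    proof cases
      case 1 then show ?thesis using P tq by (auto simp: T'.apath_simps)
    next
      case 2
      then have "a = (t, q)" using P by (auto simp: T'.apath_simps)
      then show ?thesis using 2 arcs by auto
    qed
  qed
  have "T.awalk t P q"
    using walk' arcs tq by (auto simp: T.awalk_def)
  then have walk: "T.awalk t (P @ [(q, t)]) t"
    using e T.arcs_symmetric T.in_arcsD1[OF e]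
    by (intro T.awalk_appendI[of _ _ q]) (auto simp: T.awalk_simps)
  have verts: "pawalk_verts t (P @ [(q, t)]) = pawalk_verts t P @ [t]"
    using T.awalk_verts_append[OF walk] by simp
  have "distinct (pawalk_verts t P)" using P by (simp add: T'.apath_def)
  moreover have "hd (pawalk_verts t P) = t" using P by (cases P) (auto simp: T'.apath_simps)
  ultimately have "distinct (tl (pawalk_verts t P @ [t]))"
    by (cases "pawalk_verts t P") auto
  then have "T.cycle (P @ [(q, t)])"
    unfolding T.cycle_def using walk verts by auto
  with len T show False by (auto simp: undirected_tree_def)
qed

text \<open>Connectedness is defined through the symmetric closure, which adds nothing to symmetric
  arcs.\<close>

lemma connected_symmetric_rtrancl:
  assumes "Digraph_Component.connected (with_proj T \<restriction> X)" "sym (parcs T)" "u \<in> X" "v \<in> X"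
  shows "(u, v) \<in> (Restr (parcs T) X)\<^sup>*"
proof -
  let ?M = "mk_symmetric (with_proj T \<restriction> X)"
  have "u \<rightarrow>\<^sup>*\<^bsub>with_proj ?M\<^esub> v"
    using assms by (auto simp: Digraph_Component.connected_def strongly_connected_def mk_symmetric_def)
  then have "(u, v) \<in> (parcs ?M)\<^sup>*" by (auto dest: reachable_rtranclI)
  moreover have "parcs ?M \<subseteq> Restr (parcs T) X"
    using assms(2) by (auto simp: mk_symmetric_def symD)
  ultimately show ?thesis using rtrancl_mono by blast
qed

lemma with_proj_induce_pverts:
  assumes "pair_wf_digraph T"
  shows "with_proj T \<restriction> pverts T = with_proj T"
proof -
  interpret pair_wf_digraph T by fact
  show ?thesis by (auto simp: induce_subgraph_def with_proj_def intro: in_arcsD1 in_arcsD2)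
qed

text \<open>A connected set of tree nodes grows along one arc at a time. That arc is a bridge, so a
  vertex shared by the new bag and an old one must also lie in the bag at the attachment
  point.\<close>

lemma tree_decomposition_running_intersection:
  assumes td: "tree_decomposition G T B"
  shows "running_intersection B (pverts T)"
proof -
  have T: "undirected_tree T" using td by (simp add: tree_decomposition_def)
  interpret T: pair_graph T using T by (simp add: undirected_tree_def)
  have sym: "sym (parcs T)" using T.arcs_symmetric by (auto intro: symI)
  have "Digraph_Component.connected (with_proj T)" using T by (simp add: undirected_tree_def)
  then have conn: "(u, v) \<in> (Restr (parcs T) (pverts T))\<^sup>*" if "u \<in> pverts T" "v \<in> pverts T" for u v
    using that sym with_proj_induce_pverts[OF T.pair_wf_digraph] by (intro connected_symmetric_rtrancl) auto
  have "pverts T \<noteq> {}"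
    using \<open>Digraph_Component.connected (with_proj T)\<close>
    by (auto simp: Digraph_Component.connected_def strongly_connected_def mk_symmetric_def)
  then obtain t0 where t0: "t0 \<in> pverts T" by auto
  have "\<exists>U. U \<subseteq> pverts T \<and> card U = Suc n \<and> running_intersection B U \<and>
      (\<forall>u\<in>U. \<forall>v\<in>U. (u, v) \<in> (Restr (parcs T) U)\<^sup>*)" if "Suc n \<le> card (pverts T)" for n
    using that
  proof (induction n)
    case 0
    then show ?case using t0 by (intro exI[of _ "{t0}"]) (auto intro: running_intersection.single)
  next
    case (Suc n)
    then obtain U where U: "U \<subseteq> pverts T" "card U = Suc n" "running_intersection B U"
      and UU: "\<And>u v. u \<in> U \<Longrightarrow> v \<in> U \<Longrightarrow> (u, v) \<in> (Restr (parcs T) U)\<^sup>*" by auto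
    obtain u0 where u0: "u0 \<in> U" using U by (cases "U = {}") auto
    obtain t1 where t1: "t1 \<in> pverts T" "t1 \<notin> U" 
      using U Suc.prems by (metis Suc_n_not_le_n subsetI card_mono running_intersection_finite order.trans)
    \<comment> \<open>Otherwise \<open>U\<close> would be closed under arcs and, by connectedness,
      contain \<open>t1\<close>.\<close>
    have "\<exists>q t. (q, t) \<in> parcs T \<and> q \<in> U \<and> t \<notin> U"
    proof (rule ccontr)
      assume no: "\<not> ?thesis"
      have "(u0, t1) \<in> (Restr (parcs T) (pverts T))\<^sup>*" using conn u0 t1 U by auto
      then have "t1 \<in> U" by (induction rule: rtrancl_induct) (use u0 no in auto)
      with t1 show False by simp
    qed
    then obtain q t where qt: "(q, t) \<in> parcs T" "q \<in> U" "t \<notin> U" by auto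
    then have tq: "(t, q) \<in> parcs T" "t \<in> pverts T" using T.arcs_symmetric T.in_arcsD2 by auto
    have "x \<in> B q" if x: "x \<in> B t" "x \<in> B u" and u: "u \<in> U" for x u
    proof (rule ccontr)
      assume q: "x \<notin> B q"
      have "x \<in> pverts G" using td x tq by (auto simp: tree_decomposition_def)
      then have "Digraph_Component.connected (with_proj T \<restriction> {t \<in> pverts T. x \<in> B t})"
        using td by (auto simp: tree_decomposition_def)
      then have "(t, u) \<in> (Restr (parcs T) {t \<in> pverts T. x \<in> B t})\<^sup>*"
        using x u U tq sym by (intro connected_symmetric_rtrancl) auto
      \<comment> \<open>The subtree of \<open>x\<close> misses \<open>q\<close> and \<open>U\<close>
        misses \<open>t\<close>, so neither uses the arc \<open>(t, q)\<close>; together they would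
        bypass the bridge.\<close>
      moreover have "Restr (parcs T) {t \<in> pverts T. x \<in> B t} \<subseteq> parcs T - {(t, q)}"
        using q by auto
      ultimately have "(t, u) \<in> (parcs T - {(t, q)})\<^sup>*" using rtrancl_mono by blast
      moreover have "Restr (parcs T) U \<subseteq> parcs T - {(t, q)}" using qt by auto
      then have "(u, q) \<in> (parcs T - {(t, q)})\<^sup>*" using UU[OF u qt(2)] rtrancl_mono by blast
      ultimately have "(t, q) \<in> (parcs T - {(t, q)})\<^sup>*" by (rule rtrancl_trans)
      with undirected_tree_arc_is_bridge[OF T tq(1)] show False by simp
    qed
    then have "running_intersection B (insert t U)"
      using U qt by (intro running_intersection.insert[of B U t q]) auto
    moreover have "(u, v) \<in> (Restr (parcs T) (insert t U))\<^sup>*" if uv: "u \<in> insert t U" "v \<in> insert t U" for u v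
    proof -
      let ?R = "(Restr (parcs T) (insert t U))\<^sup>*"
      have "(Restr (parcs T) U)\<^sup>* \<subseteq> ?R" by (intro rtrancl_mono) auto
      then have "(u', q) \<in> ?R" "(q, u') \<in> ?R" if "u' \<in> U" for u' using UU qt that by blast+
      moreover have "(t, q) \<in> ?R" "(q, t) \<in> ?R" using qt tq by auto
      ultimately have "(u, q) \<in> ?R" "(q, v) \<in> ?R" using uv by auto
      then show ?thesis by (rule rtrancl_trans)
    qed
    moreover have "card (insert t U) = Suc (Suc n)"
      using U qt running_intersection_finite[OF U(3)] by simp
    ultimately show ?case using U tq by (intro exI[of _ "insert t U"]) auto
  qed
  from this[of "card (pverts T) - 1"] obtain U where
    "U \<subseteq> pverts T" "card U = card (pverts T)" "running_intersection B U"
    using t0 T.pair_finite_verts by (metis Suc_pred' card_gt_0_iff empty_iff order_refl)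
  then show ?thesis using card_subset_eq[OF T.pair_finite_verts] by auto
qed

section \<open>Seeds as out-neighbours of a source\<close>

text \<open>
  \<open>None\<close> is an additional source with an edge of probability 1 to every seed, so that activation
  becomes reachability from a single vertex, which is then added to every bag.
\<close>

definition seed_arcs :: "'a set \<Rightarrow> ('a option) rel" where
  "seed_arcs S = {None} \<times> Some ` S"

definition lift_arc :: "'a \<times> 'a \<Rightarrow> 'a option \<times> 'a option" where
  "lift_arc = map_prod Some Some"

text \<open>The default value 1 makes the seed arcs live with certainty.\<close>

definition lift_prob :: "('a \<times> 'a \<Rightarrow> real) \<Rightarrow> 'a option \<times> 'a option \<Rightarrow> real" where
  "lift_prob p e = (case e of (Some u, Some v) \<Rightarrow> p (u, v) | _ \<Rightarrow> 1)"

lemma lift_arc_simps [simp]: "lift_arc (u, v) = (Some u, Some v)"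
  by (simp add: lift_arc_def)

lemma lift_prob_simps [simp]: "lift_prob p (lift_arc e) = p e" "lift_prob p (None, x) = 1"
  by (cases e) (auto simp: lift_prob_def)

lemma inj_lift_arc: "inj_on lift_arc A"
  by (auto simp: inj_on_def)

text \<open>With default value \<open>False\<close>, the product measure is concentrated on the
  indicators of subsets of \<open>parcs G\<close>.\<close>

lemma prob_live_edges:
  assumes "finite (parcs G)" "\<forall>e\<in>parcs G. 0 \<le> p e \<and> p e \<le> 1"
  shows "measure_pmf.prob (live_edges_pmf G p) {L. Q L} =
    live_expect p (parcs G) (\<lambda>L. of_bool (Q (\<lambda>e. e \<in> L)))"
proof -
  let ?E = "parcs G" and ?M = "live_edges_pmf G p" and ?c = "\<lambda>L e. e \<in> L"
  define I where "I = {L \<in> Pow ?E. Q (?c L)}"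
  have "measure_pmf.prob ?M {L. Q L} = measure_pmf.prob ?M (?c ` I)"
  proof (rule measure_prob_cong_0)
    fix f assume f: "f \<in> {L. Q L} - ?c ` I"
    have "\<not> {e. f e} \<subseteq> ?E"
    proof
      assume "{e. f e} \<subseteq> ?E"
      then have "{e. f e} \<in> I" using f by (auto simp: I_def)
      then have "f \<in> ?c ` I" by (intro image_eqI[of _ _ "{e. f e}"]) auto
      then show False using f by simp
    qed
    then show "pmf ?M f = 0" 
      using assms by (auto simp: live_edges_pmf_def intro!: pmf_Pi_outside)
  qed (auto simp: I_def)
  also have "\<dots> = (\<Sum>L\<in>I. pmf ?M (?c L))"
  proof -
    have "inj_on ?c I" by (auto simp: inj_on_def fun_eq_iff)
    moreover have "finite (?c ` I)" using assms by (simp add: I_def)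
    ultimately show ?thesis by (simp add: measure_measure_pmf_finite sum.reindex)
  qed
  also have "\<dots> = (\<Sum>L\<in>I. config_weight p ?E L)"
  proof (rule sum.cong)
    fix L assume "L \<in> I"
    then have "pmf ?M (?c L) = (\<Prod>e\<in>?E. pmf (bernoulli_pmf (p e)) (e \<in> L))"
      unfolding live_edges_pmf_def using assms by (subst pmf_Pi') (auto simp: I_def)
    \<comment> \<open>For \<open>p e\<close> in [0,1] the Bernoulli masses are exactly
      \<open>p e\<close> and \<open>1 - p e\<close>.\<close>
    also have "\<dots> = config_weight p ?E L"
      unfolding config_weight_def using assms by (intro prod.cong) auto
    finally show "pmf ?M (?c L) = config_weight p ?E L" .
  qed simp
  also have "\<dots> = live_expect p ?E (\<lambda>L. of_bool (Q (?c L)))"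
    unfolding live_expect_def using assms by (intro sum.mono_neutral_cong_left) (auto simp: I_def)
  finally show ?thesis .
qed

text \<open>No arc enters \<open>None\<close>, so a path from it to \<open>Some v\<close> is a seed
  arc followed by a lifted live path.\<close>

lemma active_iff_source_reaches:
  assumes "pair_digraph G" "S \<subseteq> pverts G" "L \<subseteq> parcs G"
  shows "active G S (\<lambda>e. e \<in> L) v \<longleftrightarrow> (None, Some v) \<in> (lift_arc ` L \<union> seed_arcs S)\<^sup>*"
proof -
  interpret G: pair_digraph G by fact
  let ?G = "live_subgraph G (\<lambda>e. e \<in> L)" and ?R = "(lift_arc ` L \<union> seed_arcs S)\<^sup>*"
  have arcs: "parcs ?G = L" "pverts ?G = pverts G" using assms by (auto simp: live_subgraph_def)
  interpret L: pair_wf_digraph ?G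
    using assms by unfold_locales (auto simp: live_subgraph_def intro: G.in_arcsD1 G.in_arcsD2)
  have "active G S (\<lambda>e. e \<in> L) v \<longleftrightarrow> (\<exists>s\<in>S. (s, v) \<in> L\<^sup>*)"
    unfolding active_def using assms(2) arcs
    by (intro bex_cong refl) (subst L.reachable_conv', auto)
  also have "\<dots> \<longleftrightarrow> (None, Some v) \<in> ?R"
  proof
    assume "\<exists>s\<in>S. (s, v) \<in> L\<^sup>*"
    then obtain s where s: "s \<in> S" "(s, v) \<in> L\<^sup>*" by auto
    from s(2) have "(Some s, Some v) \<in> ?R"
    proof (induction rule: rtrancl_induct)
      case (step b c)
      then have "(Some b, Some c) \<in> lift_arc ` L \<union> seed_arcs S"
        by (auto intro!: image_eqI[of _ _ "(b, c)"])
      with step show ?case by (meson rtrancl.rtrancl_into_rtrancl)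
    qed simp
    moreover have "(None, Some s) \<in> lift_arc ` L \<union> seed_arcs S" using s by (auto simp: seed_arcs_def)
    ultimately show "(None, Some v) \<in> ?R" by (meson converse_rtrancl_into_rtrancl)
  next
    assume "(None, Some v) \<in> ?R"
    \<comment> \<open>In this form the induction hypothesis is vacuous at the start vertex
      \<open>None\<close>.\<close>
    then have "\<forall>b. Some v = Some b \<longrightarrow> (\<exists>s\<in>S. (s, b) \<in> L\<^sup>*)"
    proof (induction rule: rtrancl_induct)
      case (step y z)
      then show ?case by (auto simp: seed_arcs_def) (meson rtrancl.rtrancl_into_rtrancl)
    qed simp
    then show "\<exists>s\<in>S. (s, v) \<in> L\<^sup>*" by auto
  qed
  finally show ?thesis .
qed

lemma live_expect_inj_image:
  assumes "inj_on f A"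
  shows "live_expect y (f ` A) h = live_expect (y \<circ> f) A (\<lambda>L. h (f ` L))"
proof -
  have "Pow (f ` A) = (`) f ` Pow A" by (simp add: image_Pow_surj)
  moreover have "inj_on ((`) f) (Pow A)" using assms by (rule inj_on_image_Pow)
  moreover have "config_weight y (f ` A) (f ` L) = config_weight (y \<circ> f) A L" if "L \<subseteq> A" for L
    unfolding config_weight_def using assms that
    by (subst prod.reindex) (auto intro!: prod.cong simp: inj_on_image_mem_iff)
  ultimately show ?thesis
    unfolding live_expect_def by (auto simp: sum.reindex intro!: sum.cong)
qed

text \<open>A configuration that omits an edge has a factor \<open>1 - 1\<close>.\<close>

lemma live_expect_certain:
  assumes "finite F" "\<And>e. e \<in> F \<Longrightarrow> y e = 1"
  shows "live_expect y F h = h F"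
proof -
  have "config_weight y F L = of_bool (L = F)" if L: "L \<subseteq> F" for L
  proof (cases "L = F")
    case True
    then show ?thesis using assms by (auto simp: config_weight_def)
  next
    case False
    then obtain e where "e \<in> F" "e \<notin> L" using L by auto
    then show ?thesis using assms False by (auto simp: config_weight_def prod_zero_iff)
  qed
  then have "live_expect y F h = (\<Sum>L\<in>Pow F. if F = L then h L else 0)"
    unfolding live_expect_def by (intro sum.cong) auto
  then show ?thesis using assms by (simp add: sum.delta')
qed

text \<open>\<open>X\<close> is left open so that the marginal of \<open>v\<close> can be read off
  at any bag containing \<open>v\<close>.\<close>

lemma activation_marginal_eq_live_expect:
  assumes G: "pair_digraph G" and S: "S \<subseteq> pverts G"
    and p: "\<forall>e\<in>parcs G. 0 \<le> p e \<and> p e \<le> 1" and X: "None \<in> X" "Some v \<in> X"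
  shows "activation_marginal G p S v =
    live_expect (lift_prob p) (lift_arc ` parcs G \<union> seed_arcs S) (\<lambda>L. of_bool ((None, Some v) \<in> reach_on X L))"
proof -
  interpret G: pair_digraph G by fact
  have fin: "finite (parcs G)" "finite (lift_arc ` parcs G)" "finite (seed_arcs S)"
    using G.pair_finite_arcs finite_subset[OF S G.pair_finite_verts] by (auto simp: seed_arcs_def)
  have "activation_marginal G p S v = live_expect p (parcs G) (\<lambda>L. of_bool (active G S (\<lambda>e. e \<in> L) v))"
    unfolding activation_marginal_def using fin p by (intro prob_live_edges)
  also have "\<dots> = live_expect p (parcs G)
      (\<lambda>L. of_bool ((None, Some v) \<in> reach_on X (lift_arc ` L \<union> seed_arcs S)))"
    using X by (intro live_expect_cong) (simp add: active_iff_source_reaches[OF G S] reach_on_def)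
  \<comment> \<open>The fixed seed arcs are rewritten as random arcs of probability 1, to be treated
    like all others.\<close>
  also have "\<dots> = live_expect (lift_prob p \<circ> lift_arc) (parcs G) (\<lambda>L. live_expect (lift_prob p) (seed_arcs S)
      (\<lambda>L'. of_bool ((None, Some v) \<in> reach_on X (lift_arc ` L \<union> L'))))"
    using fin by (subst live_expect_certain) (auto simp: seed_arcs_def comp_def)
  also have "\<dots> = live_expect (lift_prob p) (lift_arc ` parcs G) (\<lambda>L. live_expect (lift_prob p) (seed_arcs S)
      (\<lambda>L'. of_bool ((None, Some v) \<in> reach_on X (L \<union> L'))))"
    by (subst live_expect_inj_image[OF inj_lift_arc]) simp
  also have "\<dots> = live_expect (lift_prob p) (lift_arc ` parcs G \<union> seed_arcs S)
      (\<lambda>L. of_bool ((None, Some v) \<in> reach_on X L))"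
    using fin by (subst live_expect_Un) (auto simp: seed_arcs_def)
  finally show ?thesis .
qed

section \<open>Lifted bags and assembly of the program\<close>

lemma running_intersection_insert_Some:
  "running_intersection B U \<Longrightarrow> running_intersection (\<lambda>t. insert None (Some ` B t)) U"
proof (induction rule: running_intersection.induct)
  case (insert U t q)
  then show ?case by (intro running_intersection.insert[of _ U t q]) auto
qed (rule running_intersection.single)

lemma card_bag_le_td_width:
  assumes "finite (pverts T)" "t \<in> pverts T"
  shows "card (B t) \<le> td_width T B + 1"
proof -
  have "card (B t) \<le> Max ((\<lambda>t. card (B t)) ` pverts T)" using assms by (intro Max_ge) auto
  then show ?thesis unfolding td_width_def by linarith
qed

text \<open>Per bag, one unit of \<open>join_ops\<close> pays for the initial distribution and three
  for the environment; per vertex, one pays for reading off the marginal.\<close>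

lemma ic_marginals_program:
  fixes G :: "'a pair_pre_digraph" and T :: "'t pair_pre_digraph"
  assumes inst: "ic_instance G S T B"
  shows "\<exists>P. num_ops P \<le> (4 * card (pverts T) + card (pverts G)) * join_ops (td_width T B + 2) \<and>
    (\<forall>p. (\<forall>e\<in>parcs G. 0 \<le> p e \<and> p e \<le> 1) \<longrightarrow>
      computes P ((\<lambda>e. Some (p e)) |` parcs G) (pverts G) (activation_marginal G p S))"
proof -
  have G: "pair_digraph G" and S: "S \<subseteq> pverts G" and td: "tree_decomposition G T B"
    using inst by (auto simp: ic_instance_def)
  interpret G: pair_digraph G by (rule G)
  interpret T: pair_graph T using td by (simp add: tree_decomposition_def undirected_tree_def)
  \<comment> \<open>A bag has at most width + 1 vertices, and the source is one more.\<close>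
  define k where "k = td_width T B + 2"
  define X where "X t = insert None (Some ` B t)" for t
  define A where "A = lift_arc ` parcs G \<union> seed_arcs S"
  have "\<exists>t\<in>pverts T. v \<in> B t" if "v \<in> pverts G" for v
    using td that by (auto simp: tree_decomposition_def)
  then obtain \<sigma> where \<sigma>: "\<And>v. v \<in> pverts G \<Longrightarrow> \<sigma> v \<in> pverts T \<and> v \<in> B (\<sigma> v)" by metis
  have "\<exists>t\<in>pverts T. e \<in> X t \<times> X t" if "e \<in> A" for e
  proof -
    consider u v where "(u, v) \<in> parcs G" "e = (Some u, Some v)" | s where "s \<in> S" "e = (None, Some s)"
      using \<open>e \<in> A\<close> by (auto simp: A_def seed_arcs_def)
    then show ?thesis
    proof cases
      case 1
      then obtain t where "t \<in> pverts T" "u \<in> B t" "v \<in> B t"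
        using td by (auto simp: tree_decomposition_def)
      then show ?thesis using 1 by (auto simp: X_def)
    next
      case 2
      then show ?thesis using \<sigma>[of s] S by (auto simp: X_def)
    qed
  qed
  then obtain \<tau> where \<tau>: "\<And>e. e \<in> A \<Longrightarrow> \<tau> e \<in> pverts T \<and> e \<in> X (\<tau> e) \<times> X (\<tau> e)" by metis
  \<comment> \<open>Each edge is charged to a single bag, which makes the sets \<open>F t\<close>
    disjoint.\<close>
  define F where "F t = {e \<in> A. \<tau> e = t}" for t
  have finA: "finite A"
    using G.pair_finite_arcs finite_subset[OF S G.pair_finite_verts] by (auto simp: A_def seed_arcs_def)
  have F: "finite (F t)" "F t \<subseteq> X t \<times> X t" for t
    using finA \<tau> by (auto simp: F_def)
  have UF: "(\<Union>s\<in>pverts T - {t}. F s) \<union> F t = A" for t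
    using \<tau> by (auto simp: F_def)
  have X: "finite (X t) \<and> card (X t) \<le> k" if "t \<in> pverts T" for t
  proof -
    have "B t \<subseteq> pverts G" using td that by (auto simp: tree_decomposition_def)
    then have "finite (B t)" using G.pair_finite_verts by (rule finite_subset)
    then show ?thesis using card_bag_le_td_width[OF T.pair_finite_verts that, of B]
      by (simp add: X_def k_def card_image)
  qed
  define H :: "(('a \<times> 'a \<Rightarrow> real) \<Rightarrow> real) set" where
    "H = {\<lambda>p. 0, \<lambda>p. 1} \<union> (\<lambda>e p. p e) ` parcs G"
  define N where "N = (\<Union>t\<in>pverts T. dist_funs lift_prob (F t) (X t))"
  define D where "D = (\<Union>t\<in>pverts T. dist_funs lift_prob (\<Union>s\<in>pverts T - {t}. F s) (X t))"
  define m where "m v p = live_expect (lift_prob p) A (\<lambda>L. of_bool ((None, Some v) \<in> reach_on (X (\<sigma> v)) L))"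
    for v :: 'a and p
  have "(\<lambda>p. lift_prob p e) \<in> H" if "e \<in> A" for e
    using that by (auto simp: A_def seed_arcs_def H_def simp del: lift_arc_simps)
  then have "straight_line (card (pverts T) * join_ops k) H N"
    unfolding N_def using X F T.pair_finite_verts
    by (intro straight_line_UN straight_line_initial) (auto simp: H_def F_def)
  moreover have "straight_line (3 * join_ops k * card (pverts T)) (H \<union> N) D"
    unfolding D_def
  \<comment> \<open>Before any merging, the edges of a bag stay within that bag.\<close>
  proof (rule straight_line_environments[where W = X])
    show "running_intersection X (pverts T)"
      unfolding X_def using tree_decomposition_running_intersection[OF td]
      by (rule running_intersection_insert_Some)
    fix s t assume "s \<in> pverts T" "t \<in> pverts T" "s \<noteq> t"
    then show "F s \<inter> F t = {} \<and> X s \<inter> X t \<subseteq> X s" by (auto simp: F_def)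
  qed (use X F in \<open>auto simp: H_def N_def\<close>)
  moreover have "straight_line (card (pverts G) * join_ops k) (H \<union> N \<union> D) (m ` pverts G)"
  proof (rule straight_line_image[OF G.pair_finite_verts])
    fix v assume "v \<in> pverts G"
    define t where "t = \<sigma> v"
    have t: "t \<in> pverts T" using \<sigma>[OF \<open>v \<in> pverts G\<close>] by (simp add: t_def)
    define E where "E = (\<Union>s\<in>pverts T - {t}. F s)"
    define W where "W = (\<Union>s\<in>pverts T - {t}. X s)"
    have E: "finite E" "E \<inter> F t = {}" 
      unfolding E_def using F T.pair_finite_verts by (auto simp: F_def)
    \<comment> \<open>At the bag of \<open>v\<close>, its own edges and its environment make up all
      of \<open>A\<close>; only one event is evaluated, not a whole distribution.\<close>
    have "straight_line (2 * 2 ^ (2 * k\<^sup>2)) (H \<union> N \<union> D)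
      {\<lambda>p. live_expect (lift_prob p) (E \<union> F t) (\<lambda>L. of_bool ((None, Some v) \<in> reach_on (X t) L))}"
    proof (rule straight_line_join_event[of _ _ "X t" "X t" W "X t"])
      show "E \<subseteq> W \<times> W" using F(2) unfolding E_def W_def by blast
      show "dist_funs lift_prob E (X t) \<subseteq> H \<union> N \<union> D" using t by (auto simp: D_def E_def)
      show "dist_funs lift_prob (F t) (X t) \<subseteq> H \<union> N \<union> D" using t by (auto simp: N_def)
    qed (use E X[OF t] F[of t] in \<open>auto simp: H_def\<close>)
    then show "straight_line (join_ops k) (H \<union> N \<union> D) {m v}"
      unfolding E_def UF m_def t_def join_ops_def by (rule straight_line_mono) auto
  qed
  ultimately have "straight_line (card (pverts T) * join_ops k +
      (3 * join_ops k * card (pverts T) + card (pverts G) * join_ops k)) H (N \<union> (D \<union> m ` pverts G))"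
    by (rule straight_line_trans[OF _ straight_line_trans])
  then have line: "straight_line ((4 * card (pverts T) + card (pverts G)) * join_ops k) H (m ` pverts G)"
    by (rule straight_line_mono) (auto simp: algebra_simps)
  define P where "P = {p :: 'a \<times> 'a \<Rightarrow> real. \<forall>e\<in>parcs G. 0 \<le> p e \<and> p e \<le> 1}"
  have inputs: "\<exists>a. \<forall>p\<in>P. operand_value ((\<lambda>e. Some (p e)) |` parcs G) [] a = Some (f p)" if "f \<in> H" for f
  proof -
    consider "f = (\<lambda>p. 0)" | "f = (\<lambda>p. 1)" | e where "e \<in> parcs G" "f = (\<lambda>p. p e)"
      using \<open>f \<in> H\<close> by (auto simp: H_def)
    then show ?thesis
    proof cases
      case 1 then show ?thesis by (intro exI[of _ Zero]) auto
    next
      case 2 then show ?thesis by (intro exI[of _ One]) auto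
    next
      case 3 then show ?thesis by (intro exI[of _ "Input e"]) auto
    qed
  qed
  obtain cs rs where len: "length cs \<le> (4 * card (pverts T) + card (pverts G)) * join_ops k"
    and run: "\<forall>p\<in>P. run ((\<lambda>e. Some (p e)) |` parcs G) cs [] = Some (rs p)"
    and res: "\<forall>f\<in>m ` pverts G. \<exists>a. \<forall>p\<in>P. operand_value ((\<lambda>e. Some (p e)) |` parcs G) (rs p) a = Some (f p)"
    using straight_line_program[OF line, of P "\<lambda>p. (\<lambda>e. Some (p e)) |` parcs G" "[]" "\<lambda>p. []"] inputs by auto
  from res have "\<forall>v\<in>pverts G. \<exists>a. \<forall>p\<in>P. operand_value ((\<lambda>e. Some (p e)) |` parcs G) (rs p) a = Some (m v p)"
    by simp
  from bchoice[OF this] obtain out where out: "\<And>v p. v \<in> pverts G \<Longrightarrow> p \<in> P \<Longrightarrow>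
      operand_value ((\<lambda>e. Some (p e)) |` parcs G) (rs p) (out v) = Some (m v p)" by blast
  have "m v p = activation_marginal G p S v" if "v \<in> pverts G" "p \<in> P" for v p
    unfolding m_def A_def using that \<sigma>
    by (intro activation_marginal_eq_live_expect[symmetric] G S) (auto simp: P_def X_def)
  then have "computes (Program cs out) ((\<lambda>e. Some (p e)) |` parcs G) (pverts G) (activation_marginal G p S)"
    if "p \<in> P" for p
    using that run out by (auto simp: computes_def)
  then show ?thesis using len
    by (intro exI[of _ "Program cs out"]) (auto simp: num_ops_def k_def P_def)
qed

theorem theorem3p5:
  shows "\<exists>(alg :: ('a, 't) ic_algorithm) (c :: nat) (q :: nat poly).
    computes_ic_marginals alg \<and>
    (\<forall>b :: real. \<exists>K :: real. \<forall>G S T B.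
       ic_instance G S T B \<longrightarrow> real (card (pverts T)) \<le> b * real (card (pverts G)) \<longrightarrow>
       real (num_ops (alg G S T B)) \<le>
         K * (real (card (pverts G)) * 2 ^ (c * (td_width T B)\<^sup>2) * real (poly q (td_width T B)))) \<and>
    (\<forall>(b :: real) (w :: nat). \<exists>K :: real. \<forall>G S T B.
       ic_instance G S T B \<longrightarrow> real (card (pverts T)) \<le> b * real (card (pverts G)) \<longrightarrow>
       td_width T B = w \<longrightarrow>
       real (num_ops (alg G S T B)) \<le> K * real (card (pverts G)))"
proof -
  define correct :: "'a pair_pre_digraph \<Rightarrow> 'a set \<Rightarrow> 't pair_pre_digraph \<Rightarrow> ('t \<Rightarrow> 'a set) \<Rightarrow>
      ('a \<times> 'a, 'a) program \<Rightarrow> bool" where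
    "correct G S T B P \<longleftrightarrow>
      num_ops P \<le> (4 * card (pverts T) + card (pverts G)) * join_ops (td_width T B + 2) \<and>
      (\<forall>p. (\<forall>e\<in>parcs G. 0 \<le> p e \<and> p e \<le> 1) \<longrightarrow>
        computes P ((\<lambda>e. Some (p e)) |` parcs G) (pverts G) (activation_marginal G p S))" for G S T B P
  define alg :: "('a, 't) ic_algorithm" where "alg G S T B = (SOME P. correct G S T B P)" for G S T B
  have alg: "correct G S T B (alg G S T B)" if "ic_instance G S T B" for G S T B
    unfolding alg_def by (rule someI_ex) (use ic_marginals_program[OF that] in \<open>simp add: correct_def\<close>)
  have ops: "real (num_ops (alg G S T B)) \<le>
      (4 * b + 1) * 2 ^ 13 * (real (card (pverts G)) * 2 ^ (27 * (td_width T B)\<^sup>2))"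
    if "ic_instance G S T B" "real (card (pverts T)) \<le> b * real (card (pverts G))" for G S T B b
  proof -
    define w where "w = td_width T B"
    \<comment> \<open>The summand 4 covers \<open>w = 0\<close>. Multiplied by 3, the bound gives
      the exponent \<open>27 * w\<^sup>2 + 12\<close>; the leading factor 2 of
      \<open>join_ops\<close> turns 12 into 13.\<close>
    have "(w + 2)\<^sup>2 \<le> 9 * w\<^sup>2 + 4"
      by (cases w) (auto simp: power2_eq_square algebra_simps)
    then have "(2::nat) * 2 ^ (3 * (w + 2)\<^sup>2) \<le> 2 * 2 ^ (27 * w\<^sup>2 + 12)"
      by (intro mult_left_mono power_increasing) auto
    also have "\<dots> = 2 ^ 13 * 2 ^ (27 * w\<^sup>2)"
      by (simp add: power_add)
    finally have "join_ops (w + 2) \<le> 2 ^ 13 * 2 ^ (27 * w\<^sup>2)" unfolding join_ops_def .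
    then have "real (join_ops (w + 2)) \<le> real (2 ^ 13 * 2 ^ (27 * w\<^sup>2))" by (rule of_nat_mono)
    then have join: "real (join_ops (w + 2)) \<le> 2 ^ 13 * 2 ^ (27 * w\<^sup>2)"
      by (simp only: of_nat_mult of_nat_power of_nat_numeral)
    have bags: "real (4 * card (pverts T) + card (pverts G)) \<le> (4 * b + 1) * real (card (pverts G))"
      using that(2) by (simp add: algebra_simps)
    have "real (num_ops (alg G S T B)) \<le>
        real ((4 * card (pverts T) + card (pverts G)) * join_ops (w + 2))"
      using alg[OF that(1)] unfolding correct_def w_def by (intro of_nat_mono) (rule conjunct1)
    \<comment> \<open>As \<open>b\<close> is an arbitrary real, nonnegativity of the left factor is
      derived from its being an upper bound of a cardinality.\<close>
    also have "\<dots> \<le> ((4 * b + 1) * real (card (pverts G))) * (2 ^ 13 * 2 ^ (27 * w\<^sup>2))"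
      unfolding of_nat_mult using order_trans[OF of_nat_0_le_iff bags]
      by (rule mult_mono[OF bags join]) (rule of_nat_0_le_iff)
    finally show ?thesis by (simp only: w_def mult_ac)
  qed
  have "computes_ic_marginals alg"
    using alg by (auto simp: computes_ic_marginals_def correct_def)
  \<comment> \<open>With \<open>c = 27\<close> the exponential absorbs every other dependence on the
    width, so the polynomial can be 1.\<close>
  moreover have "\<exists>K. \<forall>G S T B. ic_instance G S T B \<longrightarrow>
      real (card (pverts T)) \<le> b * real (card (pverts G)) \<longrightarrow> real (num_ops (alg G S T B)) \<le>
        K * (real (card (pverts G)) * 2 ^ (27 * (td_width T B)\<^sup>2) * real (poly [:1:] (td_width T B)))" for b
    using ops by (intro exI[of _ "(4 * b + 1) * 2 ^ 13"]) auto
  moreover have "\<exists>K. \<forall>G S T B. ic_instance G S T B \<longrightarrow>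
      real (card (pverts T)) \<le> b * real (card (pverts G)) \<longrightarrow> td_width T B = w \<longrightarrow>
      real (num_ops (alg G S T B)) \<le> K * real (card (pverts G))" for b w
  proof (intro exI[of _ "(4 * b + 1) * 2 ^ 13 * 2 ^ (27 * w\<^sup>2)"] allI impI)
    fix G :: "'a pair_pre_digraph" and S and T :: "'t pair_pre_digraph" and B
    assume "ic_instance G S T B" "real (card (pverts T)) \<le> b * real (card (pverts G))" "td_width T B = w"
    then show "real (num_ops (alg G S T B)) \<le> (4 * b + 1) * 2 ^ 13 * 2 ^ (27 * w\<^sup>2) * real (card (pverts G))"
      using ops[of G S T B b] by (simp add: mult_ac)
  qed
  ultimately show ?thesis by blast
qed

end
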